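(* Let $g\ge 2$. If $$T^{2g}+a_1T^{2g-1}+a_2T^{2g-2}+\cdots+a_2q^{g-2}T^2+a_1q^{g-1}T+q^g$$ is a $q$-Weil polynomial, then $$a_2\le\frac{a_1^2(g-1)}{2g}+gq$$ and $$a_2\ge\begin{cases}\frac{g-1}{2g}a_1^2-gq & \text{when } g\ge2\text{ is even},\\[1mm] \frac{g-1}{2g}a_1^2+\frac{2-g^2}{g}q & \text{when } g\ge3\text{ is odd}.\end{cases}$$
   Context: $q$ is a power of a prime. A $q$-Weil number is an algebraic integer whose image under every embedding into $\mathbb{C}$ has absolute value $\sqrt q$. A monic polynomial in $\mathbb{Z}[T]$ is called a $q$-Weil polynomial if all its roots are $q$-Weil numbers. The displayed polynomial has degree $2g$ and integer coefficients, with the symmetry that for $0\le i\le g$ the coefficient of $T^{i}$ is $q^{g-i}$ times the coefficient of $T^{2g-i}$ (when $g=2$, $a_2T^2$ is the single middle term). *)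

theory Defs
  imports
    Complex_Main
    "HOL-Computational_Algebra.Computational_Algebra"
    "HOL-Number_Theory.Prime_Powers"
    "HOL-Algebra.Generated_Fields"
    "HOL-Algebra.Algebraic_Closure_Type"
begin

text \<open>
  Weil numbers are taken inside the complex numbers, which contain a copy of every number field.
  The embeddings in question are those of the field generated by the number over the rationals.
\<close>

abbreviation complex_ring :: "complex ring" where
  "complex_ring \<equiv> ring_of_type_algebra"

definition rat_adjoin :: "complex \<Rightarrow> complex ring" where
  "rat_adjoin \<alpha> = complex_ring\<lparr>carrier := generate_field complex_ring {\<alpha>}\<rparr>"

text \<open>Ring homomorphisms preserve the unit, so those between fields are the embeddings.\<close>

definition weil_number :: "nat \<Rightarrow> complex \<Rightarrow> bool" where
  "weil_number q \<alpha> \<longleftrightarrow>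
     algebraic_int \<alpha> \<and>
     (\<forall>\<sigma> \<in> ring_hom (rat_adjoin \<alpha>) complex_ring. norm (\<sigma> \<alpha>) = sqrt (real q))"

definition weil_poly :: "nat \<Rightarrow> int poly \<Rightarrow> bool" where
  "weil_poly q P \<longleftrightarrow>
     lead_coeff P = 1 \<and>
     (\<forall>\<alpha>::complex. poly (map_poly of_int P) \<alpha> = 0 \<longrightarrow> weil_number q \<alpha>)"

end

theory Submission
  imports Defs "HOL-Analysis.Convex"
begin

text \<open>
  Non-real roots of a real polynomial come in conjugate pairs, and positivity of the constant term
  together with evenness of the degree forces both real roots \<open>\<plusminus>\<surd>q\<close> to have even multiplicity.
  So the polynomial is a product of factors \<open>T\<^sup>2 + x\<^sub>i T + q\<close> with real \<open>\<bar>x\<^sub>i\<bar> \<le> 2\<surd>q\<close>, whence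
  \<open>a\<^sub>1 = \<Sum> x\<^sub>i\<close> and \<open>a\<^sub>1\<^sup>2 - 2a\<^sub>2 + 2gq = \<Sum> x\<^sub>i\<^sup>2\<close>. Both bounds then estimate the variance
  \<open>\<Sum> x\<^sub>i\<^sup>2 - (\<Sum> x\<^sub>i)\<^sup>2 / g\<close>: it is nonnegative, and, being convex in each \<open>x\<^sub>i\<close>, it is at most its value
  at some vertex of the cube, where \<open>\<Sum> x\<^sub>i\<close> is \<open>2\<surd>q\<close> times an integer of the parity of \<open>g\<close>.
\<close>

section \<open>Real polynomials whose complex roots lie on a circle\<close>

lemma map_poly_of_real_mult:
  "map_poly of_real (p * q) =
     (map_poly of_real p * map_poly of_real q :: 'a :: {real_algebra_1, comm_ring_1} poly)"
  by (rule poly_eqI) (simp add: coeff_map_poly coeff_mult)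

text \<open>The inclusion of the field generated by \<open>\<alpha>\<close> into the complex numbers
  is one of the embeddings.\<close>

lemma weil_number_norm:
  assumes "weil_number q \<alpha>"
  shows "norm \<alpha> = sqrt (real q)"
proof -
  have "(\<lambda>x. x) \<in> ring_hom (rat_adjoin \<alpha>) complex_ring"
    by (simp add: ring_hom_def rat_adjoin_def ring_of_type_algebra_def)
  with assms show ?thesis
    unfolding weil_number_def by fastforce
qed

text \<open>The divisor is (T - z)(T - cnj z). The remainder of \<open>p\<close> modulo it is real,
  of degree at most 1, and vanishes at the non-real \<open>z\<close>, so it is zero.\<close>

lemma quadratic_dvd_if_nonreal_root:
  fixes p :: "real poly"
  assumes root: "poly (map_poly of_real p) z = 0" and nonreal: "Im z \<noteq> 0"
  shows "[:(norm z)\<^sup>2, - 2 * Re z, 1:] dvd p"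
proof -
  define d where "d = [:(norm z)\<^sup>2, - 2 * Re z, 1:]"
  have d0: "d \<noteq> 0" and degd: "degree d = 2"
    by (simp_all add: d_def)
  have dz: "poly (map_poly of_real d) z = 0"
    by (simp add: d_def map_poly_pCons complex_eq_iff cmod_power2 algebra_simps)
      (simp add: power2_eq_square)
  define s where "s = p mod d"
  have "map_poly of_real p = map_poly of_real (p div d) * map_poly of_real d
          + (map_poly of_real s :: complex poly)"
  proof -
    have "map_poly of_real p = (map_poly of_real (p div d * d + s) :: complex poly)"
      by (simp add: s_def)
    also have "\<dots> = map_poly of_real (p div d * d) + map_poly of_real s"
      by (rule poly_eqI) (simp add: coeff_map_poly)
    finally show ?thesis
      by (simp add: map_poly_of_real_mult)
  qed
  then have sz: "poly (map_poly of_real s) z = 0"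
    using root dz by simp
  have "degree s < 2"
    using degree_mod_less[OF d0, of p] degd by (auto simp: s_def)
  then have "degree s \<le> 1" by simp
  then have s_eq: "s = [:coeff s 0, coeff s 1:]"
    by (intro poly_eqI) (auto simp: coeff_pCons coeff_eq_0 split: nat.splits)
  have "poly (map_poly of_real [:coeff s 0, coeff s 1:]) z = 0"
    using sz s_eq by simp
  then have "of_real (coeff s 0) + z * of_real (coeff s 1) = 0"
    by (simp add: map_poly_pCons)
  then have "coeff s 0 = 0 \<and> coeff s 1 = 0"
    using nonreal by (auto simp: complex_eq_iff)
  then have "s = 0"
    using s_eq by simp
  then show ?thesis
    unfolding s_def d_def by (simp add: dvd_eq_mod_eq_0)
qed

text \<open>Strong induction on the degree: each step splits off the factor of one root. The real
  roots \<open>r\<close> and \<open>- r\<close> are collected with multiplicities \<open>m\<close>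
  and \<open>n\<close>, whose parity is still open.\<close>

lemma real_poly_circle_factorization:
  fixes p :: "real poly"
  assumes "lead_coeff p = 1"
    and "\<And>z::complex. poly (map_poly of_real p) z = 0 \<Longrightarrow> norm z = r"
  shows "\<exists>xs m n. (\<forall>x\<in>set xs. \<bar>x\<bar> \<le> 2 * r) \<and>
           p = (\<Prod>x\<leftarrow>xs. [:r\<^sup>2, x, 1:]) * [:- r, 1:] ^ m * [:r, 1:] ^ n"
  using assms
proof (induction "degree p" arbitrary: p rule: less_induct)
  case less
  show ?case
  proof (cases "degree p = 0")
    case True
    then have "p = 1"
      using less.prems(1) by (metis degree_0_id of_nat_1 one_pCons)
    then show ?thesis
      by (intro exI[of _ "[]"] exI[of _ 0]) simp
  next
    case False
    have degc: "degree (map_poly of_real p :: complex poly) = degree p"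
      by (rule degree_map_poly) simp
    then have "\<not> constant (poly (map_poly of_real p :: complex poly))"
      using False by (simp add: constant_degree)
    then obtain z :: complex where z: "poly (map_poly of_real p) z = 0"
      using fundamental_theorem_of_algebra by blast
    have nz: "norm z = r"
      using less.prems(2) z by blast
    \<comment> \<open>Cofactors of monic factors of positive degree inherit both hypotheses, so the
      induction hypothesis applies to them.\<close>
    have split: "\<exists>xs m n. (\<forall>x\<in>set xs. \<bar>x\<bar> \<le> 2 * r) \<and>
           u = (\<Prod>x\<leftarrow>xs. [:r\<^sup>2, x, 1:]) * [:- r, 1:] ^ m * [:r, 1:] ^ n"
      if "p = d * u" "lead_coeff d = 1" "degree d > 0" for d u
    proof (rule less.hyps)
      have "p \<noteq> 0" using False by auto
      then have "d \<noteq> 0" "u \<noteq> 0" using that by auto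
      then show "degree u < degree p"
        using that by (simp add: degree_mult_eq)
      show "lead_coeff u = 1"
        using that less.prems(1) by (simp add: lead_coeff_mult)
      show "norm w = r" if "poly (map_poly of_real u) w = 0" for w :: complex
        using that less.prems(2)[of w] \<open>p = d * u\<close> by (simp add: map_poly_of_real_mult)
    qed
    show ?thesis
    proof (cases "Im z = 0")
      case False
      then obtain u where u: "p = [:r\<^sup>2, - 2 * Re z, 1:] * u"
        using quadratic_dvd_if_nonreal_root[OF z] nz by (auto elim: dvdE)
      obtain xs m n where xs: "\<forall>x\<in>set xs. \<bar>x\<bar> \<le> 2 * r"
        "u = (\<Prod>x\<leftarrow>xs. [:r\<^sup>2, x, 1:]) * [:- r, 1:] ^ m * [:r, 1:] ^ n"
        using split[OF u] by auto
      have "\<bar>- 2 * Re z\<bar> \<le> 2 * r"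
        using abs_Re_le_cmod[of z] nz by simp
      then show ?thesis
        using u xs
        by (intro exI[of _ "(- 2 * Re z) # xs"] exI[of _ m] exI[of _ n])
          (simp add: mult.assoc del: mult_pCons_left mult_pCons_right)
    next
      case True
      then have zr: "z = of_real (Re z)"
        by (simp add: complex_eq_iff)
      have "poly (map_poly of_real p) (of_real (Re z) :: complex) = 0"
        using z zr by simp
      moreover have "poly (map_poly of_real p) (of_real (Re z) :: complex) = of_real (poly p (Re z))"
        by (induction p) (auto simp: map_poly_pCons)
      ultimately have "poly p (Re z) = 0"
        by (metis of_real_eq_0_iff)
      then obtain u where u: "p = [:- Re z, 1:] * u"
        by (auto simp: poly_eq_0_iff_dvd elim: dvdE)
      obtain xs m n where xs: "\<forall>x\<in>set xs. \<bar>x\<bar> \<le> 2 * r"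
        "u = (\<Prod>x\<leftarrow>xs. [:r\<^sup>2, x, 1:]) * [:- r, 1:] ^ m * [:r, 1:] ^ n"
        using split[OF u] by auto
      have "\<bar>Re z\<bar> = r"
        using nz zr by (metis norm_of_real)
      then consider "Re z = r" | "Re z = - r" by linarith
      then show ?thesis
      proof cases
        case 1
        then show ?thesis
          using u xs by (intro exI[of _ xs] exI[of _ "Suc m"] exI[of _ n]) (simp only: power_Suc mult_ac simp_thms)
      next
        case 2
        then show ?thesis
          using u xs by (intro exI[of _ xs] exI[of _ m] exI[of _ "Suc n"])
            (simp only: power_Suc mult_ac simp_thms minus_minus)
      qed
    qed
  qed
qed

section \<open>Top coefficients of a product of quadratics\<close>

lemma quadratic_prod_degree:
  fixes xs :: "real list"
  shows "degree (\<Prod>x\<leftarrow>xs. [:c, x, 1:]) = 2 * length xs"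
    and "lead_coeff (\<Prod>x\<leftarrow>xs. [:c, x, 1:]) = 1"
proof (induction xs)
  case (Cons x xs)
  {
    case 1
    have "(\<Prod>x\<leftarrow>xs. [:c, x, 1:]) \<noteq> 0"
      using Cons.IH(2) by auto
    then show ?case
      using Cons.IH(1) by (simp add: degree_mult_eq del: mult_pCons_left)
  next
    case 2
    show ?case
      using Cons.IH(2) by (simp add: lead_coeff_mult del: mult_pCons_left)
  }
qed simp_all

text \<open>The second claim is twice the second elementary symmetric function, by Newton's
  identity, plus a contribution \<open>c\<close> from each factor. Length \<open>Suc k\<close>
  avoids natural subtraction in the indices.\<close>

lemma quadratic_prod_top_coeffs:
  fixes xs :: "real list"
  assumes "length xs = Suc k"
  shows "coeff (\<Prod>x\<leftarrow>xs. [:c, x, 1:]) (Suc (2 * k)) = sum_list xs \<and>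
         2 * coeff (\<Prod>x\<leftarrow>xs. [:c, x, 1:]) (2 * k) =
           (sum_list xs)\<^sup>2 - (\<Sum>x\<leftarrow>xs. x\<^sup>2) + 2 * real (Suc k) * c"
  using assms
proof (induction xs arbitrary: k)
  case (Cons x xs)
  define p where "p = (\<Prod>x\<leftarrow>xs. [:c, x, 1:])"
  have len: "length xs = k"
    using Cons.prems by simp
  have top: "coeff p (2 * k) = 1"
    using quadratic_prod_degree[of c xs] len by (simp add: p_def)
  have above: "coeff p (Suc (2 * k)) = 0"
    using quadratic_prod_degree(1)[of c xs] len by (simp add: p_def coeff_eq_0)
  have eq: "(\<Prod>x\<leftarrow>x # xs. [:c, x, 1:]) = smult c p + pCons 0 (smult x p + pCons 0 p)"
    by (simp add: p_def)
  show ?case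
  proof (cases k)
    \<comment> \<open>The induction hypothesis speaks of non-empty lists only, so the one-element
      list is treated directly.\<close>
    case 0
    then show ?thesis
      unfolding eq using top above len by simp
  next
    case (Suc j)
    have "coeff p (Suc (2 * j)) = sum_list xs"
      "2 * coeff p (2 * j) = (sum_list xs)\<^sup>2 - (\<Sum>x\<leftarrow>xs. x\<^sup>2) + 2 * real (Suc j) * c"
      using Cons.IH[of j] len Suc by (simp_all add: p_def)
    then show ?thesis
      unfolding eq using top above Suc by (simp add: power2_eq_square algebra_simps)
  qed
qed simp

section \<open>Even multiplicity of the real roots\<close>

lemma even_power_quadratic:
  fixes a :: real
  assumes "even m"
  shows "[:a, 1:] ^ m = (\<Prod>x\<leftarrow>replicate (m div 2) (2 * a). [:a\<^sup>2, x, 1:])"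
proof -
  have "[:a, 1:] ^ m = ([:a, 1:] ^ 2) ^ (m div 2)"
    using assms by (simp flip: power_mult)
  also have "[:a, 1:] ^ 2 = [:a\<^sup>2, 2 * a, 1:]"
    by (simp add: power2_eq_square)
  finally show ?thesis
    by (simp add: prod_list_replicate)
qed

text \<open>At 0 the sign of the product is that of \<open>(- r) ^ m\<close>, so a positive constant
  term makes \<open>m\<close> even; the even degree then makes \<open>n\<close> even. Both powers
  become quadratics with extremal middle coefficient \<open>- 2 * r\<close> or
  \<open>2 * r\<close>.\<close>

lemma real_poly_circle_factorization_even:
  fixes p :: "real poly"
  assumes "lead_coeff p = 1"
    and "\<And>z::complex. poly (map_poly of_real p) z = 0 \<Longrightarrow> norm z = r"
    and "r > 0" and "even (degree p)" and pos: "coeff p 0 > 0"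
  obtains xs where "\<forall>x\<in>set xs. \<bar>x\<bar> \<le> 2 * r" "p = (\<Prod>x\<leftarrow>xs. [:r\<^sup>2, x, 1:])"
proof -
  obtain xs m n where xs: "\<forall>x\<in>set xs. \<bar>x\<bar> \<le> 2 * r"
    and p: "p = (\<Prod>x\<leftarrow>xs. [:r\<^sup>2, x, 1:]) * [:- r, 1:] ^ m * [:r, 1:] ^ n"
    using real_poly_circle_factorization[OF assms(1,2)] by blast
  have "poly (\<Prod>x\<leftarrow>xs. [:r\<^sup>2, x, 1:]) 0 > 0"
    using \<open>r > 0\<close> by (induction xs) simp_all
  moreover have "poly p 0 = poly (\<Prod>x\<leftarrow>xs. [:r\<^sup>2, x, 1:]) 0 * (- r) ^ m * r ^ n"
    unfolding p by simp
  moreover have "poly p 0 > 0"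
    using pos by (simp add: poly_0_coeff_0)
  ultimately have "(- r) ^ m > 0"
    using \<open>r > 0\<close> by (simp add: zero_less_mult_iff)
  then have m: "even m"
    using \<open>r > 0\<close> power_less_zero_eq[of "- r" m] by (metis less_asym neg_less_0_iff_less)
  have "(\<Prod>x\<leftarrow>xs. [:r\<^sup>2, x, 1:]) \<noteq> 0"
    using quadratic_prod_degree(2)[of "r\<^sup>2" xs] by auto
  then have "degree p = 2 * length xs + m + n"
    unfolding p by (simp add: degree_mult_eq degree_power_eq quadratic_prod_degree)
  then have n: "even n"
    using \<open>even (degree p)\<close> m by simp
  let ?ys = "xs @ replicate (m div 2) (2 * - r) @ replicate (n div 2) (2 * r)"
  have "p = (\<Prod>x\<leftarrow>?ys. [:r\<^sup>2, x, 1:])"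
    unfolding p even_power_quadratic[OF m] even_power_quadratic[OF n]
    by (simp add: mult.assoc)
  moreover have "\<forall>x\<in>set ?ys. \<bar>x\<bar> \<le> 2 * r"
    using xs \<open>r > 0\<close> by auto
  ultimately show thesis
    using that by blast
qed

section \<open>Bounds for the variance\<close>

text \<open>For \<open>A \<ge> 1\<close> the left side is a convex function of \<open>x\<close>, so
  its maximum over the interval is at an endpoint.\<close>

lemma convex_quadratic_le_endpoint:
  fixes A M b x :: real
  assumes "A \<ge> 1" and "\<bar>x\<bar> \<le> M"
  shows "\<exists>e\<in>{-1, 1}. A * x\<^sup>2 - (b + x)\<^sup>2 \<le> A * M\<^sup>2 - (b + e * M)\<^sup>2"
proof -
  have "x\<^sup>2 \<le> M\<^sup>2"
    using power_mono[of "\<bar>x\<bar>" M 2] assms(2) by simp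
  then have sq: "(A - 1) * x\<^sup>2 \<le> (A - 1) * M\<^sup>2"
    using assms(1) by (intro mult_left_mono) auto
  have "\<bar>b * x\<bar> \<le> \<bar>b\<bar> * M"
    using assms by (simp add: abs_mult mult_left_mono)
  then have lin: "- (b * x) \<le> \<bar>b\<bar> * M"
    by linarith
  \<comment> \<open>The endpoint of sign opposite to \<open>b\<close> maximizes the linear term
    \<open>- 2 * b * x\<close>.\<close>
  define e :: real where "e = (if b \<ge> 0 then -1 else 1)"
  have "\<bar>b\<bar> * M = - (b * (e * M))"
    by (simp add: e_def)
  with sq lin have "(A - 1) * x\<^sup>2 - 2 * (b * x) \<le> (A - 1) * M\<^sup>2 - 2 * (b * (e * M))"
    by linarith
  moreover have "e\<^sup>2 = 1" "e \<in> {-1, 1}"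
    by (simp_all add: e_def)
  ultimately show ?thesis
    by (intro bexI[of _ e]) (simp_all add: power2_sum power_mult_distrib algebra_simps)
qed

text \<open>The shift \<open>c\<close> absorbs the coordinate that the induction moves to a vertex.\<close>

lemma shifted_variance_le_vertex:
  fixes xs :: "real list"
  assumes "A \<ge> 1" and "\<forall>x\<in>set xs. \<bar>x\<bar> \<le> M"
  shows "\<exists>k::int. even (k - int (length xs)) \<and>
           A * (\<Sum>x\<leftarrow>xs. x\<^sup>2) - (c + sum_list xs)\<^sup>2
             \<le> A * real (length xs) * M\<^sup>2 - (c + of_int k * M)\<^sup>2"
  using assms(2)
proof (induction xs arbitrary: c)
  case Nil
  show ?case
    by (intro exI[of _ 0]) simp
next
  case (Cons x xs)
  \<comment> \<open>First the tail moves to a vertex with \<open>x\<close> held in the shift; then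
    \<open>x\<close> moves with the tail sum fixed at \<open>of_int k * M\<close>.\<close>
  obtain k :: int where k: "even (k - int (length xs))"
    "A * (\<Sum>x\<leftarrow>xs. x\<^sup>2) - ((c + x) + sum_list xs)\<^sup>2
       \<le> A * real (length xs) * M\<^sup>2 - ((c + x) + of_int k * M)\<^sup>2"
    using Cons.IH[of "c + x"] Cons.prems by auto
  obtain e :: real where e: "e \<in> {-1, 1}"
    "A * x\<^sup>2 - ((c + of_int k * M) + x)\<^sup>2 \<le> A * M\<^sup>2 - ((c + of_int k * M) + e * M)\<^sup>2"
    using convex_quadratic_le_endpoint[OF assms(1), of x M "c + of_int k * M"] Cons.prems
    by (meson list.set_intros(1))
  \<comment> \<open>An odd step for each new coordinate keeps \<open>k\<close> congruent to the
    length modulo 2.\<close>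
  obtain e' :: int where e': "e = of_int e'" "odd e'"
  proof (cases "e = 1")
    case True
    then show thesis using that[of 1] by simp
  next
    case False
    then show thesis using that[of "-1"] e(1) by simp
  qed
  show ?case
  proof (intro exI[of _ "k + e'"] conjI)
    show "even (k + e' - int (length (x # xs)))"
      using k(1) e'(2) by auto
    show "A * (\<Sum>x\<leftarrow>x # xs. x\<^sup>2) - (c + sum_list (x # xs))\<^sup>2
        \<le> A * real (length (x # xs)) * M\<^sup>2 - (c + of_int (k + e') * M)\<^sup>2"
      using k(2) e(2) unfolding e'(1) by (simp add: algebra_simps)
  qed
qed

lemma sum_list_squared_le:
  fixes xs :: "real list"
  shows "(sum_list xs)\<^sup>2 \<le> real (length xs) * (\<Sum>x\<leftarrow>xs. x\<^sup>2)"
  using sum_squared_le_sum_of_squares[of "\<lambda>i. xs ! i" "{..<length xs}"]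
  by (simp add: sum_list_sum_nth atLeast0LessThan mult.commute)

section \<open>The bounds on the second coefficient\<close>

theorem theorem3p9:
  fixes g q :: nat and a :: "nat \<Rightarrow> int"
  assumes "primepow q"
    and "g \<ge> 2"
    and "weil_poly q
      (monom 1 (2 * g)
        + (\<Sum>i = 1..g. monom (a i) (2 * g - i))
        + (\<Sum>i = 1..<g. monom (a i * int q ^ (g - i)) i)
        + monom (int q ^ g) 0)"
  shows "real_of_int (a 2)
           \<le> (real_of_int (a 1))\<^sup>2 * (real g - 1) / (2 * real g) + real g * real q
       \<and> real_of_int (a 2)
           \<ge> (if even g
              then (real g - 1) / (2 * real g) * (real_of_int (a 1))\<^sup>2 - real g * real q
              else (real g - 1) / (2 * real g) * (real_of_int (a 1))\<^sup>2
                   + (2 - (real g)\<^sup>2) / real g * real q)"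
proof -
  define P where "P = monom 1 (2 * g)
        + (\<Sum>i = 1..g. monom (a i) (2 * g - i))
        + (\<Sum>i = 1..<g. monom (a i * int q ^ (g - i)) i)
        + monom (int q ^ g) 0"
  have q0: "q > 0"
    using \<open>primepow q\<close> by (simp add: primepow_gt_0_nat)
  \<comment> \<open>The upper sum includes \<open>i = g\<close>, so it carries the middle
    coefficient; the lower sum stops before it.\<close>
  have upper: "coeff (\<Sum>i = 1..g. monom (a i) (2 * g - i)) n =
      (if g \<le> n \<and> n < 2 * g then a (2 * g - n) else 0)" for n
  proof -
    have "coeff (\<Sum>i = 1..g. monom (a i) (2 * g - i)) n =
        (\<Sum>i = 1..g. if i = 2 * g - n \<and> n < 2 * g then a i else 0)"
      unfolding coeff_sum by (rule sum.cong) auto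
    also have "\<dots> = (if g \<le> n \<and> n < 2 * g then a (2 * g - n) else 0)"
      by (cases "n < 2 * g") auto
    finally show ?thesis .
  qed
  have coeffP: "coeff P n = (if n = 2 * g then 1 else 0)
      + (if g \<le> n \<and> n < 2 * g then a (2 * g - n) else 0)
      + (if 1 \<le> n \<and> n < g then a n * int q ^ (g - n) else 0)
      + (if n = 0 then int q ^ g else 0)" for n
    unfolding P_def coeff_add upper by (simp add: coeff_sum)
  have degP: "degree P = 2 * g"
  proof (rule antisym)
    show "degree P \<le> 2 * g"
      by (rule degree_le) (auto simp: coeffP)
    show "2 * g \<le> degree P"
      by (rule le_degree) (use \<open>g \<ge> 2\<close> in \<open>simp add: coeffP\<close>)
  qed
  define R where "R = (map_poly of_int P :: real poly)"
  have degR: "degree R = 2 * g"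
    unfolding R_def by (subst degree_map_poly) (simp_all add: degP)
  have coeffR: "coeff R n = of_int (coeff P n)" for n
    by (simp add: R_def coeff_map_poly)
  have map_R: "map_poly of_real R = (map_poly of_int P :: complex poly)"
    by (rule poly_eqI) (simp add: coeff_map_poly coeffR)
  define r where "r = sqrt (real q)"
  have r: "r > 0" "r\<^sup>2 = real q"
    using q0 by (simp_all add: r_def)
  have "norm z = r" if "poly (map_poly of_real R) z = 0" for z :: complex
    using that assms(3)[folded P_def] weil_number_norm
    unfolding map_R weil_poly_def r_def by blast
  moreover have "lead_coeff R = 1"
    unfolding degR coeffR using \<open>g \<ge> 2\<close> by (simp add: coeffP)
  moreover have "coeff R 0 > 0"
    unfolding coeffR using \<open>g \<ge> 2\<close> q0 by (simp add: coeffP)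
  ultimately obtain xs where xs: "\<forall>x\<in>set xs. \<bar>x\<bar> \<le> 2 * r"
    and R: "R = (\<Prod>x\<leftarrow>xs. [:r\<^sup>2, x, 1:])"
    using real_poly_circle_factorization_even[of R r] r(1) degR by auto
  have len: "length xs = g"
    using quadratic_prod_degree(1)[of "r\<^sup>2" xs] degR R by simp
  obtain k where k: "g = Suc k"
    using \<open>g \<ge> 2\<close> by (cases g) auto
  define s where "s = (\<Sum>x\<leftarrow>xs. x\<^sup>2)"
  have "coeff P (Suc (2 * k)) = a 1"
    using k \<open>g \<ge> 2\<close> by (simp add: coeffP)
  then have a1: "real_of_int (a 1) = sum_list xs"
    using quadratic_prod_top_coeffs[of xs k "r\<^sup>2"] len k R coeffR[of "Suc (2 * k)"] by simp
  \<comment> \<open>Here \<open>2 * k\<close> is 2g - 2, which is at least \<open>g\<close>; for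
    \<open>g = 2\<close> this is the middle term.\<close>
  have "coeff P (2 * k) = a 2"
    using k \<open>g \<ge> 2\<close> by (auto simp: coeffP)
  then have a2: "2 * real_of_int (a 2) = (real_of_int (a 1))\<^sup>2 - s + 2 * real g * real q"
    using quadratic_prod_top_coeffs[of xs k "r\<^sup>2"] len k R coeffR[of "2 * k"] a1 r(2)
    by (simp add: s_def)
  have g0: "real g > 0" "real g \<ge> 1"
    using \<open>g \<ge> 2\<close> by auto
  have low: "(real_of_int (a 1))\<^sup>2 \<le> real g * s"
    using sum_list_squared_le[of xs] len unfolding a1 s_def by simp
  \<comment> \<open>Taken with \<open>A = g\<close>, \<open>M = 2 * r\<close> and shift 0, the left
    side is \<open>g\<close> times the variance sum.\<close>
  obtain m :: int where m: "even (m - int g)"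
    "real g * s - (real_of_int (a 1))\<^sup>2 \<le> real g * real g * (2 * r)\<^sup>2 - (of_int m * (2 * r))\<^sup>2"
    using shifted_variance_le_vertex[OF g0(2) xs, of 0] len unfolding a1 s_def by auto
  have m': "real g * s - (real_of_int (a 1))\<^sup>2 \<le> 4 * real q * ((real g)\<^sup>2 - (of_int m)\<^sup>2)"
    using m(2) by (simp add: power_mult_distrib r(2) power2_eq_square[of "real g"] algebra_simps)
  have s_eq: "s = (real_of_int (a 1))\<^sup>2 + 2 * real g * real q - 2 * real_of_int (a 2)"
    using a2 by simp
  have le: "real_of_int (a 2)
           \<le> (real_of_int (a 1))\<^sup>2 * (real g - 1) / (2 * real g) + real g * real q"
    using low g0 unfolding s_eq by (simp add: field_simps power2_eq_square)
  \<comment> \<open>One bound serves both parities: \<open>t = 0\<close> gives the even case,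
    \<open>t = 1\<close> the odd one.\<close>
  have ge: "real_of_int (a 2) \<ge> (real g - 1) / (2 * real g) * (real_of_int (a 1))\<^sup>2
      + (2 * t - (real g)\<^sup>2) / real g * real q" if "t \<le> (of_int m)\<^sup>2" for t
  proof -
    have "real q * t \<le> real q * (of_int m)\<^sup>2"
      using that by (simp add: mult_left_mono)
    then have "real g * s - (real_of_int (a 1))\<^sup>2 \<le> 4 * real q * (real g)\<^sup>2 - 4 * (real q * t)"
      using m' by (simp add: algebra_simps)
    then show ?thesis
      using g0 unfolding s_eq by (simp add: field_simps power2_eq_square)
  qed
  \<comment> \<open>For odd \<open>g\<close> the integer \<open>m\<close> is odd, hence
    non-zero.\<close>
  have "1 \<le> (real_of_int m)\<^sup>2" if "odd g"
  proof -
    have "m \<noteq> 0" using that m(1) by auto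
    then have "1 \<le> m\<^sup>2" by (simp add: int_one_le_iff_zero_less)
    then show ?thesis by (metis of_int_1_le_iff of_int_power)
  qed
  then show ?thesis
    using le ge[of 0] ge[of 1] g0 by (auto simp: power2_eq_square)
qed

end
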